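(* System (S$_\lambda$) is definite on $\mathbb{N}_0$ if and only if, for some finite discrete interval $\mathcal{I}\subset\mathbb{N}_0$ with $k_0\in\mathcal{I}$, one of the following (mutually equivalent) conditions is satisfied: (i) $\operatorname{rank}\varphi(\mathcal{I})=2n$; (ii) $\ker\varphi(\mathcal{I})=\{0\}$; (iii) for some $\lambda\in\mathbb{C}$, every nontrivial solution $z(\lambda)$ of (S$_\lambda$) satisfies $\sum_{k\in\mathcal{I}}z_k^*(\lambda)\Psi_k z_k(\lambda)>0$; (iv) for some $\lambda\in\mathbb{C}$, every solution $z(\lambda)$ of (S$_\lambda$) with $\sum_{k\in\mathcal{I}}z_k^*(\lambda)\Psi_k z_k(\lambda)=0$ satisfies $z_k(\lambda)=0$ for $k\in\mathcal{I}$.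
   Context: Let $n\in\mathbb{N}$, $\mathbb{N}_0=\{0,1,2,\dots\}$ and $\mathcal{J}=\begin{pmatrix}0&I_n\\-I_n&0\end{pmatrix}$. For each $k\in\mathbb{N}_0$ let $S_k,\Psi_k\in\mathbb{C}^{2n\times2n}$ satisfy $S_k^*\mathcal{J}S_k=\mathcal{J}$, $\Psi_k^*=\Psi_k\ge0$ (positive semi-definite) and $\Psi_k\mathcal{J}\Psi_k=0$. Put $V_k=-\mathcal{J}\Psi_kS_k$ and $\mathbb{S}_k(\lambda)=S_k+\lambda V_k$, $\lambda\in\mathbb{C}$; these matrices are invertible. System (S$_\lambda$) is $z_k(\lambda)=\mathbb{S}_k(\lambda)z_{k+1}(\lambda)$, $k\in\mathbb{N}_0$; a solution (unless said otherwise) is a sequence $(z_k)_{k\in\mathbb{N}_0}$ in $\mathbb{C}^{2n}$. A discrete interval is a nonempty set of the form $\mathcal{I}=I\cap\mathbb{Z}$ with $I$ a real interval. System (S$_\lambda$) is definite on a discrete interval $\mathcal{I}\subseteq\mathbb{N}_0$ if for each $\lambda\in\mathbb{C}$ and every nontrivial solution $z(\lambda)$ of (S$_\lambda$) one has $\sum_{k\in\mathcal{I}}z_k^*(\lambda)\Psi_kz_k(\lambda)>0$ (the sum may be $+\infty$ if $\mathcal{I}$ is infinite). Fix $k_0\in\mathbb{N}_0$ and, for each $\lambda\in\mathbb{C}$, let $\Phi(\lambda)$ be the $2n\times2n$ matrix solution of (S$_\lambda$) with $\Phi_{k_0}(\lambda)=I_{2n}$. For a finite discrete interval $\mathcal{I}\subset\mathbb{N}_0$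 with $k_0\in\mathcal{I}$ put $\varphi(\lambda,\mathcal{I})=\sum_{k\in\mathcal{I}}\Phi_k^*(\lambda)\Psi_k\Phi_k(\lambda)$. Its kernel, range and rank do not depend on $\lambda$ and are denoted $\ker\varphi(\mathcal{I})$, $\operatorname{ran}\varphi(\mathcal{I})$, $\operatorname{rank}\varphi(\mathcal{I})$. *)

theory Defs
  imports "HOL-Analysis.Analysis"
begin

(* Complex 2n x 2n matrices are indexed by the disjoint sum 'n + 'n, where n = CARD('n);
   Inl and Inr pick out the first and the second block of n coordinates. *)
type_synonym 'n vec2 = "complex ^ ('n + 'n)"
type_synonym 'n mat2 = "complex ^ ('n + 'n) ^ ('n + 'n)"

definition symp_J :: "'n::finite mat2" where
  "symp_J = (\<chi> i j. case (i, j) of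
       (Inl a, Inr b) \<Rightarrow> if a = b then 1 else 0
     | (Inr a, Inl b) \<Rightarrow> if a = b then - 1 else 0
     | _ \<Rightarrow> 0)"

definition conj_transpose :: "complex ^ 'a::finite ^ 'b::finite \<Rightarrow> complex ^ 'b ^ 'a" where
  "conj_transpose A = (\<chi> i j. cnj (A $ j $ i))"

(* The number z^* A z.  It is real for Hermitian A, the only case in which this is used,
   so taking the real part loses nothing. *)
definition herm_form :: "complex ^ 'a ^ 'a::finite \<Rightarrow> complex ^ 'a \<Rightarrow> real" where
  "herm_form A z = Re (\<Sum>i\<in>UNIV. cnj (z $ i) * (A *v z) $ i)"

definition pos_semidef :: "complex ^ 'a ^ 'a::finite \<Rightarrow> bool" where
  "pos_semidef A \<longleftrightarrow> conj_transpose A = A \<and> (\<forall>z. herm_form A z \<ge> 0)"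

definition V_coeff :: "(nat \<Rightarrow> 'n::finite mat2) \<Rightarrow> (nat \<Rightarrow> 'n mat2) \<Rightarrow> nat \<Rightarrow> 'n mat2" where
  "V_coeff S \<Psi> k = - (symp_J ** \<Psi> k ** S k)"

(* mat \<mu> is the scalar matrix with diagonal \<mu>. *)
definition S_coeff ::
  "(nat \<Rightarrow> 'n::finite mat2) \<Rightarrow> (nat \<Rightarrow> 'n mat2) \<Rightarrow> complex \<Rightarrow> nat \<Rightarrow> 'n mat2" where
  "S_coeff S \<Psi> \<mu> k = S k + mat \<mu> ** V_coeff S \<Psi> k"

definition is_solution ::
  "(nat \<Rightarrow> 'n::finite mat2) \<Rightarrow> (nat \<Rightarrow> 'n mat2) \<Rightarrow> complex \<Rightarrow> (nat \<Rightarrow> 'n vec2) \<Rightarrow> bool" where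
  "is_solution S \<Psi> \<mu> z \<longleftrightarrow> (\<forall>k. z k = S_coeff S \<Psi> \<mu> k *v z (Suc k))"

definition is_matrix_solution ::
  "(nat \<Rightarrow> 'n::finite mat2) \<Rightarrow> (nat \<Rightarrow> 'n mat2) \<Rightarrow> complex \<Rightarrow> (nat \<Rightarrow> 'n mat2) \<Rightarrow> bool" where
  "is_matrix_solution S \<Psi> \<mu> Z \<longleftrightarrow> (\<forall>k. Z k = S_coeff S \<Psi> \<mu> k ** Z (Suc k))"

definition nontrivial :: "(nat \<Rightarrow> 'n::finite vec2) \<Rightarrow> bool" where
  "nontrivial z \<longleftrightarrow> (\<exists>k. z k \<noteq> 0)"

definition discrete_interval :: "nat set \<Rightarrow> bool" where
  "discrete_interval I \<longleftrightarrow> I \<noteq> {} \<and> (\<exists>R::real set. is_interval R \<and> real ` I = R \<inter> \<int>)"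

(* The sum is taken in [0, \<infinity>], since it may diverge when I is infinite. *)
definition definite_on ::
  "(nat \<Rightarrow> 'n::finite mat2) \<Rightarrow> (nat \<Rightarrow> 'n mat2) \<Rightarrow> nat set \<Rightarrow> bool" where
  "definite_on S \<Psi> I \<longleftrightarrow>
     (\<forall>\<mu> z. is_solution S \<Psi> \<mu> z \<and> nontrivial z \<longrightarrow>
        (\<Sum>\<^sub>\<infinity>k\<in>I. ennreal (herm_form (\<Psi> k) (z k))) > 0)"

definition phi ::
  "(nat \<Rightarrow> 'n::finite mat2) \<Rightarrow> (complex \<Rightarrow> nat \<Rightarrow> 'n mat2) \<Rightarrow> complex \<Rightarrow> nat set \<Rightarrow> 'n mat2" where
  "phi \<Psi> \<Phi> \<mu> I = (\<Sum>k\<in>I. conj_transpose (\<Phi> \<mu> k) ** \<Psi> k ** \<Phi> \<mu> k)"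

definition mat_ker :: "complex ^ 'a ^ 'b::finite \<Rightarrow> (complex ^ 'a::finite) set" where
  "mat_ker A = {v. A *v v = 0}"

definition positive_for ::
  "(nat \<Rightarrow> 'n::finite mat2) \<Rightarrow> (nat \<Rightarrow> 'n mat2) \<Rightarrow> nat set \<Rightarrow> complex \<Rightarrow> bool" where
  "positive_for S \<Psi> I \<mu> \<longleftrightarrow>
     (\<forall>z. is_solution S \<Psi> \<mu> z \<and> nontrivial z \<longrightarrow> (\<Sum>k\<in>I. herm_form (\<Psi> k) (z k)) > 0)"

definition null_vanishes_for ::
  "(nat \<Rightarrow> 'n::finite mat2) \<Rightarrow> (nat \<Rightarrow> 'n mat2) \<Rightarrow> nat set \<Rightarrow> complex \<Rightarrow> bool" where
  "null_vanishes_for S \<Psi> I \<mu> \<longleftrightarrow>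
     (\<forall>z. is_solution S \<Psi> \<mu> z \<and> (\<Sum>k\<in>I. herm_form (\<Psi> k) (z k)) = 0 \<longrightarrow> (\<forall>k\<in>I. z k = 0))"

end

theory Submission
  imports Defs
begin

text \<open>
  If \<open>\<Psi> k *v z k = 0\<close>, then \<open>\<Psi> k ** symp_J ** \<Psi> k = 0\<close> turns
  \<open>z k = S_coeff S \<Psi> \<mu> k *v z (Suc k)\<close> into \<open>z k = S k *v z (Suc k)\<close>. Hence the solutions
  of zero energy on an interval are the same for all \<open>\<mu>\<close> there, and all four conditions say that
  the space of initial values \<open>v\<close> with \<open>\<Psi> k *v (\<Phi> \<mu> k *v v) = 0\<close> on the interval is trivial.
  If this space is nonzero for every finite interval, then compactness of the unit
  sphere yields one nonzero initial value that works for all intervals at once.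
\<close>

section \<open>Hermitian forms and positive semidefinite matrices\<close>

text \<open>On complex vectors \<open>\<bullet>\<close> is the real part of the Hermitian inner
  product, so the positivity arguments can be carried out over the reals.\<close>

lemma herm_form_eq_inner: "herm_form A z = z \<bullet> (A *v z)"
  by (simp add: herm_form_def inner_vec_def inner_complex_def Re_sum)

lemma inner_complex_mult_cnj: "x \<bullet> (a * y) = (cnj a * x) \<bullet> (y :: complex)"
  by (simp add: inner_complex_def algebra_simps)

lemma inner_conj_transpose: "x \<bullet> (A *v y) = (conj_transpose A *v x) \<bullet> y"
proof -
  have "x \<bullet> (A *v y) = (\<Sum>i\<in>UNIV. \<Sum>j\<in>UNIV. x $ i \<bullet> (A $ i $ j * y $ j))"
    by (simp add: inner_vec_def matrix_vector_mult_def inner_sum_right)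
  also have "\<dots> = (\<Sum>j\<in>UNIV. \<Sum>i\<in>UNIV. (cnj (A $ i $ j) * x $ i) \<bullet> y $ j)"
    by (subst sum.swap) (simp add: inner_complex_mult_cnj)
  also have "\<dots> = (conj_transpose A *v x) \<bullet> y"
    by (simp add: inner_vec_def matrix_vector_mult_def inner_sum_left conj_transpose_def)
  finally show ?thesis .
qed

lemma conj_transpose_conj_transpose: "conj_transpose (conj_transpose A) = A"
  by (simp add: conj_transpose_def vec_eq_iff)

lemma matrix_vector_mult_scaleR: "A *v (c *\<^sub>R x) = c *\<^sub>R (A *v x)"
  for A :: "complex ^ 'a::finite ^ 'b::finite"
  by (simp add: vec_eq_iff matrix_vector_mult_def scaleR_sum_right)

lemma bounded_linear_matrix_vector_mult: "bounded_linear ((*v) (A :: complex ^ 'a::finite ^ 'b::finite))"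
  by (intro linear_conv_bounded_linear[THEN iffD1] linearI)
    (simp_all add: matrix_vector_right_distrib matrix_vector_mult_scaleR)

text \<open>Perturb \<open>z\<close> in the direction \<open>w = A *v z\<close>: the form becomes a
  nonnegative quadratic polynomial in a real \<open>t\<close> without constant term, so its linear
  coefficient, twice the squared norm of \<open>w\<close>, must vanish.\<close>

lemma pos_semidef_form_eq_0_iff:
  assumes "pos_semidef A"
  shows "herm_form A z = 0 \<longleftrightarrow> A *v z = 0"
proof
  assume z: "herm_form A z = 0"
  define w where "w = A *v z"
  define h where "h = herm_form A w"
  have h0: "h \<ge> 0" using assms by (simp add: h_def pos_semidef_def)
  have ineq: "0 \<le> 2 * t * (w \<bullet> w) + t\<^sup>2 * h" for t :: real
  proof -
    have "0 \<le> herm_form A (z + t *\<^sub>R w)"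
      using assms by (simp add: pos_semidef_def)
    also have "\<dots> = herm_form A z + t * (z \<bullet> (A *v w)) + t * (w \<bullet> w) + t\<^sup>2 * h"
      by (simp add: herm_form_eq_inner h_def w_def[symmetric] matrix_vector_right_distrib
          matrix_vector_mult_scaleR inner_add_left inner_add_right power2_eq_square algebra_simps)
    also have "z \<bullet> (A *v w) = w \<bullet> w"
      using assms by (simp add: inner_conj_transpose pos_semidef_def w_def)
    finally show ?thesis using z by simp
  qed
  have "w \<bullet> w = 0"
  proof (rule ccontr)
    assume "w \<bullet> w \<noteq> 0"
    \<comment> \<open>Since \<open>h\<close> may be 0, the denominator is \<open>h + 1\<close>; at
      \<open>- t\<close> the quadratic then equals \<open>- (t * t * (h + 2))\<close>, which is
      negative.\<close>
    define t where "t = w \<bullet> w / (h + 1)"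
    have "t > 0"
      using \<open>w \<bullet> w \<noteq> 0\<close> h0 by (simp add: t_def)
    have "w \<bullet> w = t * (h + 1)"
      using h0 by (simp add: t_def)
    then have eq: "2 * (- t) * (w \<bullet> w) + (- t)\<^sup>2 * h = - (t * t * (h + 2))"
      by (simp add: power2_eq_square algebra_simps)
    have "t * t * (h + 2) > 0" using \<open>t > 0\<close> h0 by simp
    then show False using ineq[of "- t"] eq by simp
  qed
  then show "A *v z = 0" by (simp add: w_def)
qed (simp add: herm_form_eq_inner)

lemma sum_matrix_vector_mult: "(\<Sum>k\<in>I. G k) *v v = (\<Sum>k\<in>I. G k *v v)"
  for G :: "'i \<Rightarrow> complex ^ 'a::finite ^ 'b::finite"
  by (induction I rule: infinite_finite_induct) (simp_all add: matrix_vector_mult_add_rdistrib)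

lemma inner_sum_conj_transpose_form:
  "v \<bullet> ((\<Sum>k\<in>I. conj_transpose (F k) ** P k ** F k) *v v) = (\<Sum>k\<in>I. herm_form (P k) (F k *v v))"
  by (simp add: sum_matrix_vector_mult inner_sum_right herm_form_eq_inner
      inner_conj_transpose[of v "conj_transpose _"] conj_transpose_conj_transpose
      flip: matrix_vector_mul_assoc)

section \<open>Full rank and the matrix \<open>symp_J\<close>\<close>

text \<open>Both conditions amount to the existence of a left inverse: one says that the rows span
  the whole space, the other that the matrix acts injectively.\<close>

lemma rank_eq_card_iff_mat_ker:
  "rank A = CARD('a) \<longleftrightarrow> mat_ker A = {0}" for A :: "complex ^ 'a::finite ^ 'b::finite"
proof -
  have "rank A = CARD('a) \<longleftrightarrow> vec.span (rows A) = UNIV"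
    unfolding row_rank_def_gen using vec.dim_eq_full[of "rows A"]
    by (simp add: vec.dimension_def card_cart_basis)
  also have "\<dots> \<longleftrightarrow> (\<exists>B. B ** A = mat 1)"
    by (simp add: matrix_left_invertible_span_rows_gen)
  also have "\<dots> \<longleftrightarrow> mat_ker A = {0}"
    unfolding matrix_left_invertible_ker mat_ker_def by auto
  finally show ?thesis .
qed

lemma symp_J_mult:
  "symp_J *v x = (\<chi> i. case i of Inl a \<Rightarrow> x $ Inr a | Inr a \<Rightarrow> - x $ Inl a)"
proof -
  have *: "(\<Sum>j\<in>UNIV. f j) = (\<Sum>a\<in>UNIV. f (Inl a)) + (\<Sum>a\<in>UNIV. f (Inr a))"
    for f :: "'n::finite + 'n \<Rightarrow> complex"
    by (simp add: UNIV_Plus_UNIV[symmetric] sum.Plus del: UNIV_Plus_UNIV)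
  show ?thesis
    by (simp add: vec_eq_iff matrix_vector_mult_def symp_J_def * if_distrib
        if_distribR cong: if_cong split: sum.split)
qed

lemma symp_J_mult_eq_0: "symp_J *v x = 0 \<longleftrightarrow> x = 0"
proof
  assume "symp_J *v x = 0"
  then have *: "(case i of Inl a \<Rightarrow> x $ Inr a | Inr a \<Rightarrow> - x $ Inl a) = 0" for i
    by (simp add: symp_J_mult vec_eq_iff)
  have "x $ i = 0" for i
    \<comment> \<open>Only one instance counts in each case, the first for \<open>Inl\<close> and
      the second for \<open>Inr\<close>; the other one contains an unspecified projection.\<close>
    using *[of "Inr (projl i)"] *[of "Inl (projr i)"] by (cases i) simp_all
  then show "x = 0" by (simp add: vec_eq_iff)
qed simp

section \<open>Discrete intervals and backward recurrences\<close>

lemma discrete_interval_convex: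
  assumes "discrete_interval I" "a \<in> I" "b \<in> I" "a \<le> k" "k \<le> b"
  shows "k \<in> I"
proof -
  obtain R :: "real set" where R: "is_interval R" "real ` I = R \<inter> \<int>"
    using assms(1) by (auto simp: discrete_interval_def)
  have "real a \<in> R" "real b \<in> R" using assms R by blast+
  then have "real k \<in> R"
    using R(1) assms(4,5) unfolding is_interval_1 by (meson of_nat_mono)
  then have "real k \<in> real ` I" using R(2) by auto
  then show ?thesis by auto
qed

lemma discrete_interval_atMost: "discrete_interval {..m::nat}"
proof -
  have "x \<in> real ` {..m}" if x: "0 \<le> x" "x \<le> real m" "x \<in> \<int>" for x
  proof -
    obtain k where "x = real k" using x(1,3) by (metis Ints_cases nonneg_int_cases of_int_0_le_iff of_int_of_nat_eq)
    then show ?thesis using x(2) by auto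
  qed
  then have "real ` {..m} = {0..real m} \<inter> \<int>" by auto
  then show ?thesis
    unfolding discrete_interval_def by (intro conjI exI[of _ "{0..real m}"]) (auto simp: is_interval_cc)
qed

text \<open>Agreement at \<open>m\<close> spreads to smaller indices by applying \<open>T\<close>,
  and to larger ones by cancelling the injective \<open>T\<close>; convexity keeps both walks inside
  \<open>I\<close>. It serves for whole solutions (\<open>I = UNIV\<close>) and for sequences that
  obey the recurrence only on an interval.\<close>

lemma backward_recurrence_unique:
  fixes x y :: "nat \<Rightarrow> 'v" and T :: "nat \<Rightarrow> 'v \<Rightarrow> 'v"
  assumes conv: "\<And>a b k. \<lbrakk>a \<in> I; b \<in> I; a \<le> k; k \<le> b\<rbrakk> \<Longrightarrow> k \<in> I"
    and inj: "\<And>k. inj (T k)"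
    and x: "\<And>k. k \<in> I \<Longrightarrow> x k = T k (x (Suc k))"
    and y: "\<And>k. k \<in> I \<Longrightarrow> y k = T k (y (Suc k))"
    and m: "m \<in> I" "x m = y m" and k: "k \<in> I"
  shows "x k = y k"
proof (cases "m \<le> k")
  case True
  from this k show ?thesis
  proof (induction k rule: dec_induct)
    case base
    then show ?case using m by simp
  next
    case (step i)
    then have i: "i \<in> I" using conv[of m "Suc i" i] m by simp
    then have "T i (x (Suc i)) = T i (y (Suc i))"
      using step.IH x[OF i] y[OF i] by simp
    then show ?case using inj by (simp add: inj_eq)
  qed
next
  case False
  then have "k \<le> m" by simp
  from this k show ?thesis
  proof (induction k rule: inc_induct)
    case base
    then show ?case using m by simp
  next
    case (step i)
    then have "Suc i \<in> I" using conv[of i m "Suc i"] m by simp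
    then show ?case using step x y by simp
  qed
qed

section \<open>Solutions and their initial values\<close>

locale symplectic_system =
  fixes S \<Psi> :: "nat \<Rightarrow> 'n::finite mat2"
    and \<Phi> :: "complex \<Rightarrow> nat \<Rightarrow> 'n mat2"
    and k0 :: nat
  assumes symplectic: "\<And>k. conj_transpose (S k) ** symp_J ** S k = symp_J"
    and psd: "\<And>k. pos_semidef (\<Psi> k)"
    and isotropic: "\<And>k. \<Psi> k ** symp_J ** \<Psi> k = 0"
    and fundamental: "\<And>\<mu>. is_matrix_solution S \<Psi> \<mu> (\<Phi> \<mu>)"
    and initial: "\<And>\<mu>. \<Phi> \<mu> k0 = mat 1"
begin

text \<open>For finite \<open>I\<close> this is the kernel of \<open>phi\<close>; the pointwise form
  also makes sense for infinite \<open>I\<close> and needs no convergence.\<close>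

definition null_space :: "complex \<Rightarrow> nat set \<Rightarrow> 'n vec2 set" where
  "null_space \<mu> I = {v. \<forall>k\<in>I. \<Psi> k *v (\<Phi> \<mu> k *v v) = 0}"

lemma S_mult_eq_0: "S k *v x = 0 \<longleftrightarrow> x = 0"
proof
  assume "S k *v x = 0"
  then have "symp_J *v x = 0"
    by (metis symplectic matrix_vector_mul_assoc matrix_vector_mult_0_right)
  then show "x = 0" by (simp add: symp_J_mult_eq_0)
qed simp

lemma S_coeff_mult:
  "S_coeff S \<Psi> \<mu> k *v x = S k *v x - \<mu> *s (symp_J *v (\<Psi> k *v (S k *v x)))"
proof -
  have "mat \<mu> *v y = \<mu> *s y" for y :: "'n vec2"
    by (simp add: vec_eq_iff matrix_vector_mult_def mat_def if_distribR if_distrib cong: if_cong)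
  moreover have "(- A) *v y = - (A *v y)" for A :: "'n mat2" and y
    by (simp add: vec_eq_iff matrix_vector_mult_def sum_negf)
  ultimately show ?thesis
    by (simp add: S_coeff_def V_coeff_def matrix_vector_mult_add_rdistrib
        flip: matrix_vector_mul_assoc)
qed

text \<open>By isotropy, \<open>\<Psi> k\<close> annihilates the term with the factor \<mu>, so the
  hypothesis says \<open>\<Psi> k *v (S k *v x) = 0\<close>; then that term vanishes for every
  parameter.\<close>

lemma S_coeff_eq_S:
  assumes "\<Psi> k *v (S_coeff S \<Psi> \<mu> k *v x) = 0"
  shows "S_coeff S \<Psi> \<nu> k *v x = S k *v x"
proof -
  have "\<Psi> k *v (symp_J *v (\<Psi> k *v y)) = 0" for y
    using isotropic by (metis matrix_vector_mul_assoc matrix_vector_mult_0)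
  then have "\<Psi> k *v (S k *v x) = 0"
    using assms by (simp add: S_coeff_mult matrix_vector_mult_diff_distrib vector_scalar_commute)
  then show ?thesis by (simp add: S_coeff_mult)
qed

text \<open>No inverse has to be computed: a vector in the kernel satisfies the hypothesis of
  \<open>S_coeff_eq_S\<close>, hence lies in the kernel of \<open>S k\<close>, which is trivial by
  symplecticity.\<close>

lemma inj_S_coeff: "inj ((*v) (S_coeff S \<Psi> \<mu> k))"
  unfolding vec.inj_iff_eq_0 by (metis S_coeff_eq_S S_mult_eq_0 matrix_vector_mult_0_right)

lemma fundamental_step: "\<Phi> \<mu> k *v v = S_coeff S \<Psi> \<mu> k *v (\<Phi> \<mu> (Suc k) *v v)"
  using fundamental unfolding is_matrix_solution_def by (metis matrix_vector_mul_assoc)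

lemma is_solution_fundamental: "is_solution S \<Psi> \<mu> (\<lambda>k. \<Phi> \<mu> k *v v)"
  unfolding is_solution_def using fundamental_step by blast

lemma is_solution_eq:
  assumes "is_solution S \<Psi> \<mu> z"
  shows "z = (\<lambda>k. \<Phi> \<mu> k *v z k0)"
proof
  fix k
  show "z k = \<Phi> \<mu> k *v z k0"
  proof (rule backward_recurrence_unique[where I = UNIV and m = k0
        and x = z and y = "\<lambda>k. \<Phi> \<mu> k *v z k0" and T = "\<lambda>k. (*v) (S_coeff S \<Psi> \<mu> k)"])
    show "z k = S_coeff S \<Psi> \<mu> k *v z (Suc k)" for k
      using assms unfolding is_solution_def by blast
  qed (auto simp: inj_S_coeff initial simp flip: fundamental_step)
qed

text \<open>Turns quantification over solutions into quantification over initial values at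
  \<open>k0\<close>.\<close>

lemma all_solutions_iff:
  "(\<forall>z. is_solution S \<Psi> \<mu> z \<longrightarrow> P z) \<longleftrightarrow> (\<forall>v. P (\<lambda>k. \<Phi> \<mu> k *v v))"
proof safe
  fix z
  assume "\<forall>v. P (\<lambda>k. \<Phi> \<mu> k *v v)" "is_solution S \<Psi> \<mu> z"
  then show "P z" using is_solution_eq[of \<mu> z] by metis
qed (simp add: is_solution_fundamental)

lemma nontrivial_fundamental: "nontrivial (\<lambda>k. \<Phi> \<mu> k *v v) \<longleftrightarrow> v \<noteq> 0"
  unfolding nontrivial_def
  by (metis initial matrix_vector_mul_lid matrix_vector_mult_0_right)

section \<open>Independence of the spectral parameter\<close>

text \<open>A solution for \<mu> with zero energy on \<open>I\<close> also obeys the recurrence for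
  \<nu> there. Both solutions start from \<open>v\<close> at \<open>k0\<close>, so they coincide on
  \<open>I\<close>.\<close>

lemma null_space_mono_parameter:
  assumes I: "discrete_interval I" "k0 \<in> I"
  shows "null_space \<mu> I \<subseteq> null_space \<nu> I"
proof
  fix v
  assume v: "v \<in> null_space \<mu> I"
  have "\<Phi> \<mu> k *v v = \<Phi> \<nu> k *v v" if "k \<in> I" for k
  proof (rule backward_recurrence_unique[where I = I and m = k0
        and T = "\<lambda>k. (*v) (S_coeff S \<Psi> \<nu> k)"])
    show "k \<in> I" if "a \<in> I" "b \<in> I" "a \<le> k" "k \<le> b" for a b k
      using discrete_interval_convex[OF I(1)] that by blast
    show "\<Phi> \<mu> k *v v = S_coeff S \<Psi> \<nu> k *v (\<Phi> \<mu> (Suc k) *v v)" if "k \<in> I" for k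
    proof -
      have "\<Psi> k *v (S_coeff S \<Psi> \<mu> k *v (\<Phi> \<mu> (Suc k) *v v)) = 0"
        using v that by (simp add: null_space_def flip: fundamental_step)
      \<comment> \<open>\<open>S_coeff_eq_S\<close> is needed at \<nu> and at \<mu> itself: both
        coefficient matrices act on this vector as \<open>S k\<close>.\<close>
      then show ?thesis by (metis S_coeff_eq_S fundamental_step)
    qed
  qed (use I that in \<open>auto simp: inj_S_coeff initial simp flip: fundamental_step\<close>)
  then show "v \<in> null_space \<nu> I" using v by (simp add: null_space_def)
qed

lemma null_space_parameter:
  assumes "discrete_interval I" "k0 \<in> I"
  shows "null_space \<mu> I = null_space \<nu> I"
  using null_space_mono_parameter[OF assms] by blast

section \<open>The finite conditions in terms of the null space\<close>

lemma herm_form_nonneg: "herm_form (\<Psi> k) z \<ge> 0"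
  using psd by (simp add: pos_semidef_def)

lemma energy_eq_0_iff:
  assumes "finite I"
  shows "(\<Sum>k\<in>I. herm_form (\<Psi> k) (\<Phi> \<mu> k *v v)) = 0 \<longleftrightarrow> v \<in> null_space \<mu> I"
  using assms
  by (simp add: sum_nonneg_eq_0_iff herm_form_nonneg pos_semidef_form_eq_0_iff[OF psd] null_space_def)

text \<open>For a kernel vector, pairing with \<open>v\<close> turns the matrix equation into zero
  total energy, and a sum of nonnegative terms vanishes only termwise.\<close>

lemma mat_ker_phi:
  assumes "finite I"
  shows "mat_ker (phi \<Psi> \<Phi> \<mu> I) = null_space \<mu> I"
proof (intro set_eqI iffI)
  fix v
  assume "v \<in> mat_ker (phi \<Psi> \<Phi> \<mu> I)"
  then have "v \<bullet> (phi \<Psi> \<Phi> \<mu> I *v v) = 0" by (simp add: mat_ker_def)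
  then show "v \<in> null_space \<mu> I"
    using energy_eq_0_iff[OF assms] by (simp add: phi_def inner_sum_conj_transpose_form)
next
  fix v
  assume v: "v \<in> null_space \<mu> I"
  then show "v \<in> mat_ker (phi \<Psi> \<Phi> \<mu> I)"
    by (simp add: mat_ker_def phi_def null_space_def sum_matrix_vector_mult
        flip: matrix_vector_mul_assoc)
qed

lemma zero_in_null_space: "0 \<in> null_space \<mu> I"
  by (simp add: null_space_def)

lemma positive_for_iff:
  assumes "finite I"
  shows "positive_for S \<Psi> I \<mu> \<longleftrightarrow> null_space \<mu> I = {0}"
proof -
  have zero_less_iff: "(\<Sum>k\<in>I. herm_form (\<Psi> k) (\<Phi> \<mu> k *v v)) > 0 \<longleftrightarrow> v \<notin> null_space \<mu> I" for v
    using sum_nonneg[of I "\<lambda>k. herm_form (\<Psi> k) (\<Phi> \<mu> k *v v)"]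
    by (simp add: herm_form_nonneg order_less_le eq_commute[of 0] flip: energy_eq_0_iff[OF assms])
  have "positive_for S \<Psi> I \<mu> \<longleftrightarrow>
    (\<forall>v. v \<noteq> 0 \<longrightarrow> (\<Sum>k\<in>I. herm_form (\<Psi> k) (\<Phi> \<mu> k *v v)) > 0)"
    by (simp add: positive_for_def imp_conjL all_solutions_iff nontrivial_fundamental)
  also have "\<dots> \<longleftrightarrow> (\<forall>v. v \<noteq> 0 \<longrightarrow> v \<notin> null_space \<mu> I)"
    by (simp add: zero_less_iff)
  also have "\<dots> \<longleftrightarrow> null_space \<mu> I = {0}"
    using zero_in_null_space by blast
  finally show ?thesis .
qed

lemma null_vanishes_for_iff:
  assumes "finite I" "k0 \<in> I"
  shows "null_vanishes_for S \<Psi> I \<mu> \<longleftrightarrow> null_space \<mu> I = {0}"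
proof -
  have "null_vanishes_for S \<Psi> I \<mu> \<longleftrightarrow>
    (\<forall>v\<in>null_space \<mu> I. \<forall>k\<in>I. \<Phi> \<mu> k *v v = 0)"
    by (simp add: null_vanishes_for_def imp_conjL all_solutions_iff energy_eq_0_iff[OF assms(1)]
        Ball_def[of "null_space \<mu> I"])
  \<comment> \<open>Here \<open>k0 \<in> I\<close> is decisive: vanishing on \<open>I\<close>
    includes the index \<open>k0\<close>, where the solution takes the value
    \<open>v\<close>.\<close>
  also have "\<dots> \<longleftrightarrow> (\<forall>v\<in>null_space \<mu> I. v = 0)"
    using assms(2) by (metis initial matrix_vector_mul_lid matrix_vector_mult_0_right)
  also have "\<dots> \<longleftrightarrow> null_space \<mu> I = {0}"
    using zero_in_null_space by blast
  finally show ?thesis .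
qed

section \<open>Compactness and definiteness on all of the natural numbers\<close>

lemma closed_null_space: "closed (null_space \<mu> I)"
proof -
  have "null_space \<mu> I = (\<Inter>k\<in>I. {v. \<Psi> k *v (\<Phi> \<mu> k *v v) = 0})"
    by (auto simp: null_space_def)
  moreover have "closed {v. \<Psi> k *v (\<Phi> \<mu> k *v v) = 0}" for k
    by (intro closed_Collect_eq continuous_on_const linear_continuous_on
        bounded_linear_compose[OF bounded_linear_matrix_vector_mult bounded_linear_matrix_vector_mult])
  ultimately show ?thesis by auto
qed

lemma null_space_scaleR: "v \<in> null_space \<mu> I \<Longrightarrow> c *\<^sub>R v \<in> null_space \<mu> I"
  by (simp add: null_space_def matrix_vector_mult_scaleR)

lemma null_space_antimono: "I \<subseteq> J \<Longrightarrow> null_space \<mu> J \<subseteq> null_space \<mu> I"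
  by (auto simp: null_space_def)

lemma null_space_UNIV_trivial:
  assumes "null_space \<mu> UNIV = {0}"
  shows "\<exists>m\<ge>k0. null_space \<mu> {..m} = {0}"
proof (rule ccontr)
  assume "\<not> ?thesis"
  then have nz: "null_space \<mu> {..k0 + m} \<noteq> {0}" for m by auto
  let ?F = "\<lambda>m. sphere 0 1 \<inter> null_space \<mu> {..k0 + m}"
  \<comment> \<open>The sets \<open>?F m\<close> are nonempty, compact and decreasing; intersecting
    with the unit sphere keeps a common point away from 0.\<close>
  have "\<Inter> (range ?F) \<noteq> {}"
  proof (rule compact_nest)
    show "compact (?F m)" for m
      by (intro compact_Int_closed compact_sphere closed_null_space)
    show "?F m \<noteq> {}" for m
    proof -
      obtain v where "v \<in> null_space \<mu> {..k0 + m}" "v \<noteq> 0"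
        using nz[of m] zero_in_null_space by blast
      then have "(1 / norm v) *\<^sub>R v \<in> ?F m"
        using null_space_scaleR by auto
      then show ?thesis by blast
    qed
    show "?F n \<subseteq> ?F m" if "m \<le> n" for m n
      using null_space_antimono[of "{..k0 + m}" "{..k0 + n}"] that by auto
  qed
  then obtain v where v: "v \<in> ?F m" for m by blast
  have "v \<in> null_space \<mu> UNIV"
    unfolding null_space_def
  proof clarify
    fix k
    \<comment> \<open>The index \<open>k\<close> lies in \<open>{..k0 + k}\<close>.\<close>
    show "\<Psi> k *v (\<Phi> \<mu> k *v v) = 0" using v[of k] by (simp add: null_space_def)
  qed
  then have "v = 0" using assms by blast
  then show False using v[of 0] by simp
qed

lemma infinite_energy_eq_0_iff:
  "(\<Sum>\<^sub>\<infinity>k. ennreal (herm_form (\<Psi> k) (\<Phi> \<mu> k *v v))) = 0 \<longleftrightarrow> v \<in> null_space \<mu> UNIV"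
    (is "infsum ?f UNIV = 0 \<longleftrightarrow> _")
proof
  assume *: "infsum ?f UNIV = 0"
  have "herm_form (\<Psi> k) (\<Phi> \<mu> k *v v) = 0" for k
  proof -
    have "infsum ?f {k} \<le> infsum ?f UNIV" by (rule infsum_mono_neutral) (auto intro: nonneg_summable_on_complete)
    \<comment> \<open>\<open>ennreal\<close> sends negative reals to 0, so a zero term only bounds
      the form above by 0; nonnegativity gives equality.\<close>
    then show ?thesis using * herm_form_nonneg[of k "\<Phi> \<mu> k *v v"] by (simp add: ennreal_eq_0_iff)
  qed
  then show "v \<in> null_space \<mu> UNIV"
    by (simp add: null_space_def pos_semidef_form_eq_0_iff[OF psd])
next
  assume "v \<in> null_space \<mu> UNIV"
  then show "infsum ?f UNIV = 0"
    by (intro infsum_0) (simp add: null_space_def pos_semidef_form_eq_0_iff[OF psd, THEN iffD2])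
qed

lemma definite_on_UNIV_iff:
  "definite_on S \<Psi> UNIV \<longleftrightarrow> (\<forall>\<mu>. null_space \<mu> UNIV = {0})"
proof -
  have "definite_on S \<Psi> UNIV \<longleftrightarrow>
    (\<forall>\<mu> v. v \<noteq> 0 \<longrightarrow> (\<Sum>\<^sub>\<infinity>k. ennreal (herm_form (\<Psi> k) (\<Phi> \<mu> k *v v))) > 0)"
    by (simp add: definite_on_def imp_conjL all_solutions_iff nontrivial_fundamental)
  also have "\<dots> \<longleftrightarrow> (\<forall>\<mu> v. v \<noteq> 0 \<longrightarrow> v \<notin> null_space \<mu> UNIV)"
    by (simp add: zero_less_iff_neq_zero infinite_energy_eq_0_iff)
  also have "\<dots> \<longleftrightarrow> (\<forall>\<mu>. null_space \<mu> UNIV = {0})"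
    using zero_in_null_space by blast
  finally show ?thesis .
qed

text \<open>Definiteness speaks of all parameters, the right-hand side of the single \<nu>. Forward,
  compactness at \<nu> alone provides the interval; backward, \<open>null_space_parameter\<close>
  carries triviality on \<open>I\<close> to every \<mu>, and enlarging the index set only shrinks
  the null space.\<close>

lemma definite_on_UNIV_iff_finite:
  "definite_on S \<Psi> UNIV \<longleftrightarrow>
    (\<exists>I. discrete_interval I \<and> finite I \<and> k0 \<in> I \<and> null_space \<nu> I = {0})"
proof
  assume "definite_on S \<Psi> UNIV"
  then obtain m where "m \<ge> k0" "null_space \<nu> {..m} = {0}"
    using null_space_UNIV_trivial definite_on_UNIV_iff by blast
  then show "\<exists>I. discrete_interval I \<and> finite I \<and> k0 \<in> I \<and> null_space \<nu> I = {0}"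
    by (intro exI[of _ "{..m}"]) (simp add: discrete_interval_atMost)
next
  assume "\<exists>I. discrete_interval I \<and> finite I \<and> k0 \<in> I \<and> null_space \<nu> I = {0}"
  then obtain I where "discrete_interval I" "k0 \<in> I" "null_space \<nu> I = {0}" by blast
  then have "null_space \<mu> UNIV = {0}" for \<mu>
    using null_space_parameter[of I \<mu> \<nu>] null_space_antimono[of I UNIV \<mu>]
      zero_in_null_space[of \<mu> UNIV] by auto
  then show "definite_on S \<Psi> UNIV" by (simp add: definite_on_UNIV_iff)
qed

end

theorem corollary3p10:
  fixes S \<Psi> :: "nat \<Rightarrow> 'n::finite mat2"
    and \<Phi> :: "complex \<Rightarrow> nat \<Rightarrow> 'n mat2"
    and k0 :: nat
  assumes "\<And>k. conj_transpose (S k) ** symp_J ** S k = symp_J"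
    and "\<And>k. pos_semidef (\<Psi> k)"
    and "\<And>k. \<Psi> k ** symp_J ** \<Psi> k = 0"
    and "\<And>\<mu>. is_matrix_solution S \<Psi> \<mu> (\<Phi> \<mu>)"
    and "\<And>\<mu>. \<Phi> \<mu> k0 = mat 1"
  shows
    "(\<forall>\<nu> I. discrete_interval I \<and> finite I \<and> k0 \<in> I \<longrightarrow>
        (rank (phi \<Psi> \<Phi> \<nu> I) = 2 * CARD('n) \<longleftrightarrow> mat_ker (phi \<Psi> \<Phi> \<nu> I) = {0}) \<and>
        (mat_ker (phi \<Psi> \<Phi> \<nu> I) = {0} \<longleftrightarrow> (\<exists>\<mu>. positive_for S \<Psi> I \<mu>)) \<and>
        ((\<exists>\<mu>. positive_for S \<Psi> I \<mu>) \<longleftrightarrow> (\<exists>\<mu>. null_vanishes_for S \<Psi> I \<mu>)))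
     \<and> (\<forall>\<nu>. definite_on S \<Psi> UNIV \<longleftrightarrow>
        (\<exists>I. discrete_interval I \<and> finite I \<and> k0 \<in> I \<and>
           (rank (phi \<Psi> \<Phi> \<nu> I) = 2 * CARD('n) \<or>
            mat_ker (phi \<Psi> \<Phi> \<nu> I) = {0} \<or>
            (\<exists>\<mu>. positive_for S \<Psi> I \<mu>) \<or>
            (\<exists>\<mu>. null_vanishes_for S \<Psi> I \<mu>))))"
proof -
  interpret symplectic_system S \<Psi> \<Phi> k0
    using assms by unfold_locales
  have rank: "rank (phi \<Psi> \<Phi> \<nu> I) = 2 * CARD('n) \<longleftrightarrow> mat_ker (phi \<Psi> \<Phi> \<nu> I) = {0}" for \<nu> I
    using rank_eq_card_iff_mat_ker[of "phi \<Psi> \<Phi> \<nu> I"] by (simp add: mult_2)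
  \<comment> \<open>Parameter independence allows the existentially chosen \<mu> of the last two
    conditions to be replaced by the \<nu> of \<open>phi\<close>, so all conditions reduce to
    one.\<close>
  have ker: "mat_ker (phi \<Psi> \<Phi> \<nu> I) = {0} \<longleftrightarrow> null_space \<nu> I = {0}"
    and pos: "(\<exists>\<mu>. positive_for S \<Psi> I \<mu>) \<longleftrightarrow> null_space \<nu> I = {0}"
    and van: "(\<exists>\<mu>. null_vanishes_for S \<Psi> I \<mu>) \<longleftrightarrow> null_space \<nu> I = {0}"
    if "discrete_interval I" "finite I" "k0 \<in> I" for \<nu> I
    using that null_space_parameter[OF that(1,3), of _ \<nu>]
    by (auto simp: mat_ker_phi positive_for_iff null_vanishes_for_iff)
  show ?thesis
  proof (intro conjI allI impI)
    fix \<nu> I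
    assume "discrete_interval I \<and> finite I \<and> k0 \<in> I"
    then have I: "discrete_interval I" "finite I" "k0 \<in> I" by simp_all
    show "rank (phi \<Psi> \<Phi> \<nu> I) = 2 * CARD('n) \<longleftrightarrow> mat_ker (phi \<Psi> \<Phi> \<nu> I) = {0}"
      by (rule rank)
    show "mat_ker (phi \<Psi> \<Phi> \<nu> I) = {0} \<longleftrightarrow> (\<exists>\<mu>. positive_for S \<Psi> I \<mu>)"
      unfolding ker[OF I, of \<nu>] pos[OF I, of \<nu>] ..
    show "(\<exists>\<mu>. positive_for S \<Psi> I \<mu>) \<longleftrightarrow> (\<exists>\<mu>. null_vanishes_for S \<Psi> I \<mu>)"
      unfolding van[OF I, of \<nu>] pos[OF I, of \<nu>] ..
  next
    fix \<nu>
    show "definite_on S \<Psi> UNIV \<longleftrightarrow>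
        (\<exists>I. discrete_interval I \<and> finite I \<and> k0 \<in> I \<and>
           (rank (phi \<Psi> \<Phi> \<nu> I) = 2 * CARD('n) \<or>
            mat_ker (phi \<Psi> \<Phi> \<nu> I) = {0} \<or>
            (\<exists>\<mu>. positive_for S \<Psi> I \<mu>) \<or>
            (\<exists>\<mu>. null_vanishes_for S \<Psi> I \<mu>)))"
      unfolding definite_on_UNIV_iff_finite[of \<nu>]
      by (intro ex_cong1) (simp add: rank ker[of _ \<nu>] pos[of _ \<nu>] van[of _ \<nu>] cong: conj_cong)
  qed
qed

end
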